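(* There is an absolute constant $C>0$ such that for every $\kappa\ge 1$ there exists a (deterministic) online algorithm for constrained convex function chasing that is $C\sqrt{\kappa}$-competitive on all instances (in every dimension $d$, for every convex action set $K\subseteq\mathbb{R}^d$ and every starting point $x_0\in K$) in which every request function $f_t$ has condition number at most $\kappa$.
   Context: Constrained convex function chasing (CFC/SOCO) in Euclidean space: a dimension $d\ge1$, a convex action set $K\subseteq\mathbb{R}^d$ and a starting point $x_0\in K$ are fixed. Non-negative, convex, differentiable functions $f_1,f_2,\dots,f_T:\mathbb{R}^d\to[0,\infty)$ arrive one at a time; after seeing $f_t$ (and only $f_1,\dots,f_t$) the online algorithm must choose $x_t\in K$. The cost of a sequence $X=(x_1,\dots,x_T)$ is $\mathrm{cost}(X)=\sum_{t=1}^T\big(\|x_t-x_{t-1}\|_2+f_t(x_t)\big)$. $OPT$ denotes the infimum of $\mathrm{cost}(Y)$ over all sequences $Y=(y_1,\dots,y_T)$ in $K$ with $y_0=x_0$ (chosen offline with knowledge of all functions). An algorithm is $c$-competitive if for every instance its cost is at most $c\cdot OPT$. A differentiable $f$ is $\alpha$-strongly convex if $f(y)-f(x)-\langle\nabla f(x),y-x\rangle\ge\frac{\alpha}{2}\|x-y\|_2^2$ for all $x,y$, and $\beta$-smooth if $f(y)-f(x)-\langle\nabla f(x),y-x\rangle\le\frac{\beta}{2}\|x-y\|_2^2$ for all $x,y$. $f$ has condition number at most $\kappa$ ($\kappa$-well-conditioned) if there is some $\alpha>0$ (which may differ from function to function) such that $f$ is $\alpha$-strongly convex and $\alpha\kappa$-smooth.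 *)

theory Defs
  imports Complex_Main "HOL-Library.FuncSet" "Jordan_Normal_Form.Matrix"
begin

text \<open>
  The constant in the theorem is uniform in the dimension, so the dimension is a number and not a
  type: \<open>\<real>\<^sup>d\<close> is \<^term>\<open>carrier_vec d :: real vec set\<close>.
\<close>

type_synonym point = "real vec"

type_synonym request = "point \<Rightarrow> real"

definition norm2 :: "point \<Rightarrow> real" where
  "norm2 v = sqrt (v \<bullet> v)"

definition convex_set :: "point set \<Rightarrow> bool" where
  "convex_set K \<longleftrightarrow>
    (\<forall>x\<in>K. \<forall>y\<in>K. \<forall>s\<in>{0..1}. (1 - s) \<cdot>\<^sub>v x + s \<cdot>\<^sub>v y \<in> K)"

definition convex_fun :: "nat \<Rightarrow> request \<Rightarrow> bool" where
  "convex_fun d f \<longleftrightarrow>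
    (\<forall>x\<in>carrier_vec d. \<forall>y\<in>carrier_vec d. \<forall>s\<in>{0..1}.
      f ((1 - s) \<cdot>\<^sub>v x + s \<cdot>\<^sub>v y) \<le> (1 - s) * f x + s * f y)"

definition has_gradient :: "nat \<Rightarrow> request \<Rightarrow> point \<Rightarrow> point \<Rightarrow> bool" where
  "has_gradient d f x g \<longleftrightarrow> g \<in> carrier_vec d \<and>
    (\<forall>\<epsilon>>0. \<exists>\<delta>>0. \<forall>y\<in>carrier_vec d. norm2 (y - x) < \<delta> \<longrightarrow>
      \<bar>f y - f x - g \<bullet> (y - x)\<bar> \<le> \<epsilon> * norm2 (y - x))"

definition gradient :: "nat \<Rightarrow> request \<Rightarrow> point \<Rightarrow> point" where
  "gradient d f x = (THE g. has_gradient d f x g)"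

definition differentiable_fun :: "nat \<Rightarrow> request \<Rightarrow> bool" where
  "differentiable_fun d f \<longleftrightarrow> (\<forall>x\<in>carrier_vec d. \<exists>g. has_gradient d f x g)"

definition strongly_convex :: "nat \<Rightarrow> real \<Rightarrow> request \<Rightarrow> bool" where
  "strongly_convex d \<alpha> f \<longleftrightarrow>
    (\<forall>x\<in>carrier_vec d. \<forall>y\<in>carrier_vec d.
      f y - f x - gradient d f x \<bullet> (y - x) \<ge> \<alpha> / 2 * (norm2 (x - y))\<^sup>2)"

definition smooth_fun :: "nat \<Rightarrow> real \<Rightarrow> request \<Rightarrow> bool" where
  "smooth_fun d \<beta> f \<longleftrightarrow>
    (\<forall>x\<in>carrier_vec d. \<forall>y\<in>carrier_vec d.
      f y - f x - gradient d f x \<bullet> (y - x) \<le> \<beta> / 2 * (norm2 (x - y))\<^sup>2)"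

definition well_conditioned :: "nat \<Rightarrow> real \<Rightarrow> request \<Rightarrow> bool" where
  "well_conditioned d \<kappa> f \<longleftrightarrow>
    (\<exists>\<alpha>>0. strongly_convex d \<alpha> f \<and> smooth_fun d (\<alpha> * \<kappa>) f)"

text \<open>
  Requests are extensional functions on \<open>\<real>\<^sup>d\<close>, so an algorithm receives nothing but
  the values on \<open>\<real>\<^sup>d\<close>.
\<close>

definition requests :: "nat \<Rightarrow> request set" where
  "requests d =
    {f \<in> carrier_vec d \<rightarrow>\<^sub>E {0..}. convex_fun d f \<and> differentiable_fun d f}"

definition cfc_instance :: "nat \<Rightarrow> point set \<Rightarrow> point \<Rightarrow> request list \<Rightarrow> bool" where
  "cfc_instance d K x\<^sub>0 fs \<longleftrightarrow>
    d \<ge> 1 \<and> K \<subseteq> carrier_vec d \<and> convex_set K \<and> x\<^sub>0 \<in> K \<and> set fs \<subseteq> requests d"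

text \<open>
  With 0-based lists, \<open>fs ! t\<close> and \<open>xs ! t\<close> are the request and the action of round
  \<open>t + 1\<close>, and \<open>(x\<^sub>0 # xs) ! t\<close> is the preceding action.
\<close>

definition cost :: "point \<Rightarrow> request list \<Rightarrow> point list \<Rightarrow> real" where
  "cost x\<^sub>0 fs xs =
    (\<Sum>t<length fs. norm2 (xs ! t - (x\<^sub>0 # xs) ! t) + (fs ! t) (xs ! t))"

definition OPT :: "point set \<Rightarrow> point \<Rightarrow> request list \<Rightarrow> real" where
  "OPT K x\<^sub>0 fs = Inf {cost x\<^sub>0 fs ys | ys. length ys = length fs \<and> set ys \<subseteq> K}"

text \<open>
  A deterministic online algorithm knows the dimension, the action set and the starting point, and
  maps the requests \<open>[f\<^sub>1, \<dots>, f\<^sub>t]\<close> seen so far to the action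
  \<open>x\<^sub>t\<close>; it knows neither the later requests nor their number.
\<close>

type_synonym algorithm = "nat \<Rightarrow> point set \<Rightarrow> point \<Rightarrow> request list \<Rightarrow> point"

definition actions ::
  "algorithm \<Rightarrow> nat \<Rightarrow> point set \<Rightarrow> point \<Rightarrow> request list \<Rightarrow> point list" where
  "actions A d K x\<^sub>0 fs = map (\<lambda>t. A d K x\<^sub>0 (take (Suc t) fs)) [0..<length fs]"

definition online_algorithm :: "algorithm \<Rightarrow> bool" where
  "online_algorithm A \<longleftrightarrow>
    (\<forall>d K x\<^sub>0 fs. cfc_instance d K x\<^sub>0 fs \<longrightarrow> set (actions A d K x\<^sub>0 fs) \<subseteq> K)"

definition competitive_on ::
  "(nat \<Rightarrow> point set \<Rightarrow> point \<Rightarrow> request list \<Rightarrow> bool) \<Rightarrow> real \<Rightarrow> algorithm \<Rightarrow> bool" where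
  "competitive_on \<I> c A \<longleftrightarrow>
    (\<forall>d K x\<^sub>0 fs. \<I> d K x\<^sub>0 fs \<longrightarrow>
      cost x\<^sub>0 fs (actions A d K x\<^sub>0 fs) \<le> c * OPT K x\<^sub>0 fs)"

definition well_conditioned_instance ::
  "real \<Rightarrow> nat \<Rightarrow> point set \<Rightarrow> point \<Rightarrow> request list \<Rightarrow> bool" where
  "well_conditioned_instance \<kappa> d K x\<^sub>0 fs \<longleftrightarrow>
    cfc_instance d K x\<^sub>0 fs \<and> (\<forall>f\<in>set fs. well_conditioned d \<kappa> f)"

lemma norm2_smult: "norm2 (s \<cdot>\<^sub>v v) = \<bar>s\<bar> * norm2 v"
proof -
  have "(s \<cdot>\<^sub>v v) \<bullet> (s \<cdot>\<^sub>v v) = s\<^sup>2 * (v \<bullet> v)"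
    by (simp add: scalar_prod_def sum_distrib_left power2_eq_square algebra_simps)
  then show ?thesis
    by (simp add: norm2_def real_sqrt_mult)
qed

lemma scalar_prod_self_nonneg: "v \<bullet> v \<ge> 0" for v :: point
  by (simp add: scalar_prod_def sum_nonneg)

lemma norm2_nonneg: "norm2 v \<ge> 0"
  by (simp add: norm2_def scalar_prod_self_nonneg)

lemma scalar_prod_self_eq_norm2: "v \<bullet> v = norm2 v * norm2 v"
  by (simp add: norm2_def scalar_prod_self_nonneg)

lemma has_gradient_unique:
  assumes x: "x \<in> carrier_vec d" and g: "has_gradient d f x g" and h: "has_gradient d f x h"
  shows "g = h"
proof (rule ccontr)
  assume "g \<noteq> h"
  have gd: "g \<in> carrier_vec d" and hd: "h \<in> carrier_vec d"
    using g h by (auto simp: has_gradient_def)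
  define w where "w = g - h"
  have w: "w \<in> carrier_vec d" using gd hd by (simp add: w_def)
  define r where "r = norm2 w"
  obtain i where i: "i < d" "g $ i \<noteq> h $ i"
    using \<open>g \<noteq> h\<close> gd hd by (metis carrier_vecD eq_vecI)
  have "w \<bullet> w = (\<Sum>j<d. (w $ j)\<^sup>2)"
    using w by (simp add: scalar_prod_def power2_eq_square atLeast0LessThan)
  also have "\<dots> > 0"
    using i gd hd by (intro sum_pos2[of _ i]) (auto simp: w_def)
  finally have r: "r > 0" by (simp add: r_def norm2_def)
  from g r obtain a where a: "a > 0" "\<And>y. y \<in> carrier_vec d \<Longrightarrow> norm2 (y - x) < a \<Longrightarrow>
      \<bar>f y - f x - g \<bullet> (y - x)\<bar> \<le> r / 4 * norm2 (y - x)"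
    unfolding has_gradient_def by (metis divide_pos_pos zero_less_numeral)
  from h r obtain b where b: "b > 0" "\<And>y. y \<in> carrier_vec d \<Longrightarrow> norm2 (y - x) < b \<Longrightarrow>
      \<bar>f y - f x - h \<bullet> (y - x)\<bar> \<le> r / 4 * norm2 (y - x)"
    unfolding has_gradient_def by (metis divide_pos_pos zero_less_numeral)
  define s where "s = min a b / (2 * r)"
  have s: "s > 0" using a b r by (simp add: s_def)
  define y where "y = x + s \<cdot>\<^sub>v w"
  have y: "y \<in> carrier_vec d" using x w by (simp add: y_def)
  have yx: "y - x = s \<cdot>\<^sub>v w" using x w by (auto simp: y_def)
  have n: "norm2 (y - x) = s * r" using s by (simp add: yx norm2_smult r_def)
  have lt: "s * r < a" "s * r < b" using a b r by (auto simp: s_def)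
  have "g \<bullet> (y - x) - h \<bullet> (y - x) = w \<bullet> (y - x)"
    using gd hd y x by (simp add: w_def minus_scalar_prod_distrib[of _ d])
  also have "\<dots> = s * (r * r)"
    using w by (simp add: yx r_def scalar_prod_self_eq_norm2)
  finally have eq: "g \<bullet> (y - x) - h \<bullet> (y - x) = s * (r * r)" .
  have "s * (r * r) \<le> r / 4 * (s * r) + r / 4 * (s * r)"
    using a(2)[OF y] b(2)[OF y] lt eq unfolding n by linarith
  moreover have "s * (r * r) > 0" using s r by simp
  ultimately show False by (simp add: algebra_simps)
qed

lemma has_gradient_gradient:
  assumes "differentiable_fun d f" "x \<in> carrier_vec d"
  shows "has_gradient d f x (gradient d f x)"
  using assms has_gradient_unique unfolding differentiable_fun_def gradient_def
  by (metis (no_types, lifting) theI')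

end

theory Submission
  imports Defs "HOL-Analysis.L2_Norm"
begin

text \<open>
  From \<open>p\<close>, on request \<open>f\<close>, the algorithm moves to a point \<open>x \<in> K\<close> that nearly minimizes
  \<open>max (f x) (norm2 (x - p))\<close> over \<open>K\<close>; let \<open>M\<close> be the infimum. Near-minimizers suffice, so \<open>K\<close> need
  not be closed. The potential is a multiple of \<open>sqrt \<kappa>\<close> times the distance to the offline
  position \<open>y\<close>. If \<open>f y \<ge> M / 4\<close>, the offline cost pays for everything. Otherwise, moving \<open>x\<close> slightly
  towards \<open>y\<close> lowers \<open>f\<close>, and this gain can be traded for a small move back towards \<open>p\<close>: \<open>sqrt f\<close> is
  \<open>sqrt (\<alpha> * \<kappa> / 2)\<close>-Lipschitz by smoothness, while \<open>norm2 (x - y)\<close> is at most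
  \<open>3 * sqrt (M / \<alpha>)\<close> by strong convexity. Since the resulting point cannot have
  value below \<open>M\<close>, the step from \<open>p\<close> to \<open>x\<close> must make an angle with the direction from \<open>x\<close> to \<open>y\<close>
  whose cosine is at least of order \<open>1 / sqrt \<kappa>\<close>, so the distance to \<open>y\<close> drops by at least order \<open>M / sqrt \<kappa>\<close>.
\<close>

section \<open>The Euclidean norm on coordinate vectors\<close>

lemma norm2_power2: "(norm2 v)\<^sup>2 = v \<bullet> v"
  by (simp add: scalar_prod_self_eq_norm2 power2_eq_square)

lemma norm2_add_power2:
  assumes "a \<in> carrier_vec d" "b \<in> carrier_vec d"
  shows "(norm2 (a + b))\<^sup>2 = (norm2 a)\<^sup>2 + 2 * (a \<bullet> b) + (norm2 b)\<^sup>2"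
  using assms comm_scalar_prod[OF assms]
  by (simp add: norm2_power2 scalar_prod_add_distrib[of _ d] add_scalar_prod_distrib[of _ d])

lemma norm2_uminus: "norm2 (- v) = norm2 v"
  by (simp add: norm2_def scalar_prod_def)

lemma norm2_minus_commute:
  assumes "a \<in> carrier_vec d" "b \<in> carrier_vec d"
  shows "norm2 (a - b) = norm2 (b - a)"
proof -
  have "a - b = - (b - a)" using assms by auto
  then show ?thesis by (simp only: norm2_uminus)
qed

lemma norm2_eq_L2_set:
  assumes "a \<in> carrier_vec d"
  shows "norm2 a = L2_set (($) a) {..<d}"
  using assms
  by (simp add: norm2_def L2_set_def scalar_prod_def atLeast0LessThan power2_eq_square)

lemma scalar_prod_le_norm2:
  assumes a: "a \<in> carrier_vec d" and b: "b \<in> carrier_vec d"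
  shows "a \<bullet> b \<le> norm2 a * norm2 b"
proof -
  have "a \<bullet> b \<le> (\<Sum>i<d. \<bar>a $ i\<bar> * \<bar>b $ i\<bar>)"
    using b by (simp add: scalar_prod_def atLeast0LessThan flip: abs_mult) (auto intro!: sum_mono)
  also have "\<dots> \<le> norm2 a * norm2 b"
    using L2_set_mult_ineq norm2_eq_L2_set[OF a] norm2_eq_L2_set[OF b] by metis
  finally show ?thesis .
qed

lemma norm2_triangle:
  assumes "a \<in> carrier_vec d" "b \<in> carrier_vec d"
  shows "norm2 (a + b) \<le> norm2 a + norm2 b"
proof (rule power2_le_imp_le)
  show "(norm2 (a + b))\<^sup>2 \<le> (norm2 a + norm2 b)\<^sup>2"
    using scalar_prod_le_norm2[OF assms] norm2_add_power2[OF assms] by (simp add: power2_sum)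
qed (simp add: norm2_nonneg)

lemma norm2_diff_triangle:
  assumes "x \<in> carrier_vec d" "y \<in> carrier_vec d" "z \<in> carrier_vec d"
  shows "norm2 (x - z) \<le> norm2 (x - y) + norm2 (y - z)"
proof -
  have "x - z = (x - y) + (y - z)" using assms by auto
  then show ?thesis using norm2_triangle[of "x - y" d "y - z"] assms by simp
qed

section \<open>Nonnegative smooth and strongly convex functions\<close>

lemma gradient_carrier:
  assumes "differentiable_fun d f" "x \<in> carrier_vec d"
  shows "gradient d f x \<in> carrier_vec d"
  using has_gradient_gradient[OF assms] by (simp add: has_gradient_def)

text \<open>A gradient step of size \<open>1 / \<beta>\<close> lowers \<open>f\<close> by at least
  the squared gradient norm divided by \<open>2 * \<beta>\<close>, and the value reached is still
  nonnegative.\<close>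

lemma smooth_nonneg_gradient_bound:
  assumes \<beta>: "\<beta> > 0" and sm: "smooth_fun d \<beta> f" and df: "differentiable_fun d f"
    and nn: "\<And>u. u \<in> carrier_vec d \<Longrightarrow> f u \<ge> 0" and x: "x \<in> carrier_vec d"
  shows "(norm2 (gradient d f x))\<^sup>2 \<le> 2 * \<beta> * f x"
proof -
  define g where "g = gradient d f x"
  have g: "g \<in> carrier_vec d" using gradient_carrier[OF df x] by (simp add: g_def)
  define y where "y = x - (1 / \<beta>) \<cdot>\<^sub>v g"
  have y: "y \<in> carrier_vec d" using x g by (simp add: y_def)
  have yx: "y - x = (- 1 / \<beta>) \<cdot>\<^sub>v g" and xy: "x - y = (1 / \<beta>) \<cdot>\<^sub>v g"
    using x g by (auto simp: y_def)
  have "f y - f x - g \<bullet> (y - x) \<le> \<beta> / 2 * (norm2 (x - y))\<^sup>2"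
    using sm x y by (simp add: smooth_fun_def g_def)
  moreover have "g \<bullet> (y - x) = - (norm2 g)\<^sup>2 / \<beta>"
    using g by (simp add: yx norm2_power2)
  moreover have "(norm2 (x - y))\<^sup>2 = (norm2 g)\<^sup>2 / \<beta>\<^sup>2"
    by (simp add: xy norm2_smult power_divide)
  ultimately have "f y - f x + (norm2 g)\<^sup>2 / \<beta> \<le> (norm2 g)\<^sup>2 / (2 * \<beta>)"
    using \<beta> by (simp add: power2_eq_square)
  with nn[OF y] have "(norm2 g)\<^sup>2 / \<beta> - (norm2 g)\<^sup>2 / (2 * \<beta>) \<le> f x" by linarith
  then have "(norm2 g)\<^sup>2 / (2 * \<beta>) \<le> f x" by (simp add: field_simps)
  then show ?thesis using \<beta> by (simp add: g_def field_simps)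
qed

text \<open>The gradient bound and Cauchy-Schwarz turn the quadratic upper bound on
  \<open>f y\<close> into a perfect square.\<close>

lemma sqrt_smooth_lipschitz:
  assumes \<beta>: "\<beta> > 0" and sm: "smooth_fun d \<beta> f" and df: "differentiable_fun d f"
    and nn: "\<And>u. u \<in> carrier_vec d \<Longrightarrow> f u \<ge> 0"
    and x: "x \<in> carrier_vec d" and y: "y \<in> carrier_vec d"
  shows "sqrt (f y) \<le> sqrt (f x) + sqrt (\<beta> / 2) * norm2 (y - x)"
proof (rule real_le_lsqrt)
  define g where "g = gradient d f x"
  define n where "n = norm2 (y - x)"
  have n0: "n \<ge> 0" by (simp add: n_def norm2_nonneg)
  have g: "g \<in> carrier_vec d" using gradient_carrier[OF df x] by (simp add: g_def)
  have "norm2 g \<le> sqrt (2 * \<beta> * f x)"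
    using smooth_nonneg_gradient_bound[OF \<beta> sm df nn x] by (simp add: g_def real_le_rsqrt)
  also have "\<dots> = sqrt (4 * ((\<beta> / 2) * f x))" by simp
  also have "\<dots> = 2 * (sqrt (\<beta> / 2) * sqrt (f x))" by (simp only: real_sqrt_mult) simp
  finally have ng: "norm2 g \<le> 2 * (sqrt (\<beta> / 2) * sqrt (f x))" .
  have "f y \<le> f x + g \<bullet> (y - x) + \<beta> / 2 * n\<^sup>2"
    using sm x y norm2_minus_commute[OF x y] by (fastforce simp: smooth_fun_def g_def n_def)
  also have "g \<bullet> (y - x) \<le> norm2 g * n"
    using scalar_prod_le_norm2[of g d "y - x"] g x y by (simp add: n_def)
  also have "norm2 g * n \<le> 2 * (sqrt (\<beta> / 2) * sqrt (f x)) * n"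
    by (rule mult_right_mono[OF ng n0])
  finally have "f y \<le> f x + 2 * (sqrt (\<beta> / 2) * sqrt (f x)) * n + \<beta> / 2 * n\<^sup>2" by simp
  also have "\<dots> = (sqrt (f x) + sqrt (\<beta> / 2) * n)\<^sup>2"
    using nn[OF x] \<beta> by (simp add: power2_sum power_mult_distrib)
  finally show "f y \<le> (sqrt (f x) + sqrt (\<beta> / 2) * norm2 (y - x))\<^sup>2" by (simp add: n_def)
qed (use \<beta> nn x in \<open>auto simp: norm2_nonneg\<close>)

text \<open>Expanding \<open>f\<close> at the midpoint towards both ends cancels the gradient terms,
  and the value at the midpoint is nonnegative. Hence two points of small value are close to each
  other.\<close>

lemma strongly_convex_nonneg_dist_bound:
  assumes sc: "strongly_convex d \<alpha> f" and df: "differentiable_fun d f"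
    and nn: "\<And>u. u \<in> carrier_vec d \<Longrightarrow> f u \<ge> 0"
    and x: "x \<in> carrier_vec d" and y: "y \<in> carrier_vec d"
  shows "\<alpha> * (norm2 (y - x))\<^sup>2 \<le> 4 * (f x + f y)"
proof -
  define v where "v = (1/2) \<cdot>\<^sub>v (y - x)"
  define m where "m = x + v"
  have v: "v \<in> carrier_vec d" using x y by (simp add: v_def)
  have m: "m \<in> carrier_vec d" using x v by (simp add: m_def)
  define g where "g = gradient d f m"
  have g: "g \<in> carrier_vec d" using gradient_carrier[OF df m] by (simp add: g_def)
  have e: "x - m = - v" "m - x = v" "y - m = v" "m - y = - v"
    using x y by (auto simp: m_def v_def field_simps)
  have "f x - f m - g \<bullet> (- v) \<ge> \<alpha> / 2 * (norm2 v)\<^sup>2"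
    using sc m x by (fastforce simp: strongly_convex_def g_def e)
  moreover have "f y - f m - g \<bullet> v \<ge> \<alpha> / 2 * (norm2 (- v))\<^sup>2"
    using sc m y by (fastforce simp: strongly_convex_def g_def e)
  ultimately have "f x + f y - 2 * f m \<ge> \<alpha> * (norm2 v)\<^sup>2"
    using g v by (simp add: norm2_uminus)
  moreover have "(norm2 v)\<^sup>2 = (norm2 (y - x))\<^sup>2 / 4"
    by (simp add: v_def norm2_smult power_mult_distrib power_divide)
  ultimately show ?thesis using nn[OF m] by simp
qed

section \<open>Progress of a near-minimizer towards cheap points\<close>

lemma convex_setD:
  assumes "convex_set K" "x \<in> K" "y \<in> K" "0 \<le> s" "s \<le> 1"
  shows "(1 - s) \<cdot>\<^sub>v x + s \<cdot>\<^sub>v y \<in> K"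
  using assms by (simp add: convex_set_def)

text \<open>Here \<open>s\<close> is the fraction of the way from \<open>x\<close> to
  \<open>y\<close> that the competitor takes, and \<open>\<epsilon>\<close> is the relative slack in
  the near-minimality of \<open>x\<close>. The last two bounds on \<open>s\<close> give
  \<open>r \<le> 1\<close> and keep the second-order term of the move within the budget
  \<open>T\<close>. The last two bounds on \<open>\<epsilon>\<close> make the slack small against
  the gain in \<open>f\<close> and against \<open>T\<close>.\<close>

lemma near_minimizer_angle:
  fixes \<alpha> \<kappa> M s \<epsilon> :: real
  defines "\<sigma> \<equiv> sqrt (\<alpha> * \<kappa> / 2)"
  assumes \<alpha>: "\<alpha> > 0" and \<kappa>: "\<kappa> \<ge> 1"
    and sc: "strongly_convex d \<alpha> f" and sm: "smooth_fun d (\<alpha> * \<kappa>) f"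
    and f: "f \<in> requests d"
    and Kd: "K \<subseteq> carrier_vec d" and K: "convex_set K"
    and p: "p \<in> K" and x: "x \<in> K" and y: "y \<in> K"
    and M: "M > 0" and lower: "\<And>u. u \<in> K \<Longrightarrow> M \<le> max (f u) (norm2 (u - p))"
    and s: "0 < s" "s \<le> 1" "s \<le> 24 * \<sigma> * sqrt M" "s \<le> \<alpha> * sqrt M / (864 * \<sigma>)"
    and \<epsilon>: "0 < \<epsilon>" "\<epsilon> \<le> s / 4" "\<epsilon> \<le> s / (288 * \<sigma> * sqrt M)"
    and fx: "f x \<le> (1 + \<epsilon>) * M" and xp: "norm2 (x - p) \<le> (1 + \<epsilon>) * M"
    and fy: "f y < M / 4"
  shows "M * norm2 (y - x) / (576 * sqrt \<kappa>) < (x - p) \<bullet> (y - x)"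
proof (rule ccontr)
  define \<mu> where "\<mu> = sqrt M"
  define D where "D = norm2 (y - x)"
  define P where "P = (x - p) \<bullet> (y - x)"
  \<comment> \<open>The way back is as long as the gain in \<open>f\<close> allows: it raises
    \<open>sqrt f\<close> by at most \<open>s / 12 * \<mu>\<close>, while the move towards
    \<open>y\<close> brings it down to \<open>(1 - s / 4) * \<mu>\<close>. Shrinking by
    \<open>1 - r\<close> is then worth \<open>4 * T\<close> on the scale of squared distances;
    slack, second-order term and inner product may cost \<open>T\<close> each, which leaves a strict
    gain.\<close>
  define r where "r = s / (24 * \<sigma> * \<mu>)"
  define T where "T = s * M * \<mu> / (96 * \<sigma>)"
  assume "\<not> ?thesis"
  then have P: "P \<le> M * D / (576 * sqrt \<kappa>)" by (simp add: D_def P_def)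
  have xc: "x \<in> carrier_vec d" and yc: "y \<in> carrier_vec d" and pc: "p \<in> carrier_vec d"
    using x y p Kd by auto
  have \<beta>: "\<alpha> * \<kappa> > 0" using \<alpha> \<kappa> by simp
  have df: "differentiable_fun d f" and cf: "convex_fun d f"
    and nn: "\<And>u. u \<in> carrier_vec d \<Longrightarrow> f u \<ge> 0"
    using f by (auto simp: requests_def)
  have \<sigma>: "\<sigma> > 0" using \<beta> by (simp add: \<sigma>_def)
  have \<mu>: "\<mu> > 0" and \<mu>2: "\<mu> * \<mu> = M" using M by (simp_all add: \<mu>_def)
  have D0: "D \<ge> 0" by (simp add: D_def norm2_nonneg)
  have T: "T > 0" using s M \<mu> \<sigma> by (simp add: T_def)
  have r: "0 < r" "r \<le> 1" using s \<sigma> \<mu> by (simp_all add: r_def \<mu>_def)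
  have rM: "r * M\<^sup>2 = 4 * T"
    using \<sigma> \<mu> unfolding r_def T_def \<mu>2[symmetric] by (simp add: field_simps power2_eq_square)
  have \<epsilon>1: "\<epsilon> \<le> 1" using \<epsilon> s by simp

  \<comment> \<open>The constant is \<open>4 * (2 + 1 / 4) = 9\<close>.\<close>
  have "\<alpha> * D\<^sup>2 \<le> 4 * (f x + f y)"
    unfolding D_def by (rule strongly_convex_nonneg_dist_bound[OF sc df nn xc yc])
  also have "f x \<le> 2 * M"
    using order.trans[OF fx] mult_right_mono[of "1 + \<epsilon>" 2 M] \<epsilon>1 M by simp
  finally have aD: "\<alpha> * D\<^sup>2 \<le> 9 * M" using fy by simp
  then have D2: "D\<^sup>2 \<le> 9 * M / \<alpha>" using \<alpha> by (simp add: field_simps)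
  then have "D \<le> sqrt (9 * M / \<alpha>)" by (simp add: real_le_rsqrt)
  also have "\<dots> = 3 * \<mu> / sqrt \<alpha>"
    by (simp add: \<mu>_def real_sqrt_divide real_sqrt_mult)
  finally have D: "D \<le> 3 * \<mu> / sqrt \<alpha>" .

  have T1: "3 * \<epsilon> * M\<^sup>2 \<le> T"
  proof -
    have "3 * \<epsilon> * M\<^sup>2 \<le> 3 * (s / (288 * \<sigma> * \<mu>)) * M\<^sup>2"
      using \<epsilon>(3) by (intro mult_right_mono mult_left_mono) (simp_all add: \<mu>_def)
    also have "\<dots> = T"
      using \<sigma> \<mu> unfolding T_def \<mu>2[symmetric] by (simp add: field_simps power2_eq_square)
    finally show ?thesis .
  qed
  have T2: "s\<^sup>2 * D\<^sup>2 \<le> T"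
  proof -
    have "s\<^sup>2 * D\<^sup>2 \<le> s\<^sup>2 * (9 * M / \<alpha>)" by (intro mult_left_mono D2) simp
    also have "\<dots> = s * (9 * s * M / \<alpha>)" by (simp add: power2_eq_square)
    also have "\<dots> \<le> s * (9 * (\<alpha> * \<mu> / (864 * \<sigma>)) * M / \<alpha>)"
      using s \<alpha> M by (intro mult_left_mono divide_right_mono mult_right_mono) (simp_all add: \<mu>_def)
    also have "\<dots> = T" using \<alpha> by (simp add: T_def)
    finally show ?thesis .
  qed
  \<comment> \<open>Only here does the negated conclusion enter. The factor
    \<open>1 / sqrt \<alpha>\<close> from \<open>D\<close> and \<open>1 / sqrt \<kappa>\<close> from
    \<open>P\<close> combine to at most \<open>1 / \<sigma>\<close>, the scale of
    \<open>T\<close>.\<close>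
  have T3: "2 * s * P \<le> T"
  proof -
    have "\<sigma> \<le> sqrt \<alpha> * sqrt \<kappa>"
      using \<beta> by (simp add: \<sigma>_def flip: real_sqrt_mult)
    have "P \<le> M * (3 * \<mu> / sqrt \<alpha>) / (576 * sqrt \<kappa>)"
      using P order.trans D M \<kappa> by (meson divide_right_mono mult_left_mono
          less_imp_le mult_nonneg_nonneg real_sqrt_ge_zero zero_le_numeral zero_le_one)
    also have "\<dots> = M * \<mu> / 192 / (sqrt \<alpha> * sqrt \<kappa>)" by simp
    also have "\<dots> \<le> M * \<mu> / 192 / \<sigma>"
      using \<open>\<sigma> \<le> _\<close> M \<mu> \<sigma> by (intro divide_left_mono) (auto intro: mult_pos_pos)
    finally have "2 * s * P \<le> 2 * s * (M * \<mu> / 192 / \<sigma>)"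
      using s by (intro mult_left_mono) simp_all
    then show ?thesis by (simp add: T_def mult_ac)
  qed

  \<comment> \<open>The competitor \<open>z\<close> goes from \<open>x\<close> a little towards \<open>y\<close> and then back towards \<open>p\<close>; it beats \<open>M\<close> in both terms.\<close>
  define w where "w = (1 - s) \<cdot>\<^sub>v x + s \<cdot>\<^sub>v y"
  define z where "z = (1 - r) \<cdot>\<^sub>v w + r \<cdot>\<^sub>v p"
  have w: "w \<in> K" using convex_setD[OF K x y] s by (simp add: w_def)
  have z: "z \<in> K" using convex_setD[OF K w p] r by (simp add: z_def)
  have wc: "w \<in> carrier_vec d" and zc: "z \<in> carrier_vec d" using w z Kd by auto
  have wp: "w - p = (x - p) + s \<cdot>\<^sub>v (y - x)"
    using xc yc pc by (auto simp: w_def algebra_simps)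
  have zp: "z - p = (1 - r) \<cdot>\<^sub>v (w - p)"
    using wc pc by (auto simp: z_def algebra_simps)
  have zw: "z - w = r \<cdot>\<^sub>v (p - w)"
    using wc pc by (auto simp: z_def algebra_simps)

  have "(norm2 (w - p))\<^sup>2 = (norm2 (x - p))\<^sup>2 + 2 * s * P + s\<^sup>2 * D\<^sup>2"
    using norm2_add_power2[of "x - p" d "s \<cdot>\<^sub>v (y - x)"] xc yc pc
    by (simp add: wp P_def D_def norm2_smult power_mult_distrib)
  also have "(norm2 (x - p))\<^sup>2 \<le> ((1 + \<epsilon>) * M)\<^sup>2"
    using xp by (intro power_mono) (simp_all add: norm2_nonneg)
  also have "((1 + \<epsilon>) * M)\<^sup>2 \<le> (1 + 3 * \<epsilon>) * M\<^sup>2"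
  proof -
    have "\<epsilon> * \<epsilon> \<le> \<epsilon>" using \<epsilon> \<epsilon>1 mult_left_mono[of \<epsilon> 1 \<epsilon>] by simp
    then have "(1 + \<epsilon>)\<^sup>2 \<le> 1 + 3 * \<epsilon>" by (simp add: power2_eq_square algebra_simps)
    then show ?thesis by (simp add: power_mult_distrib mult_right_mono)
  qed
  finally have wp2: "(norm2 (w - p))\<^sup>2 \<le> M\<^sup>2 + 3 * T"
    using T1 T2 T3 by (simp add: algebra_simps)

  have "norm2 (z - p) < M"
  proof (rule power2_less_imp_less)
    have "(norm2 (z - p))\<^sup>2 = (1 - r)\<^sup>2 * (norm2 (w - p))\<^sup>2"
      by (simp add: zp norm2_smult power_mult_distrib)
    also have "\<dots> \<le> (1 - r) * (M\<^sup>2 + 3 * T)"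
      using r wp2 by (intro mult_mono) (simp_all add: power2_eq_square mult_left_le)
    also have "\<dots> = M\<^sup>2 - T - 3 * r * T" using rM by (simp add: algebra_simps)
    also have "\<dots> < M\<^sup>2" using T r mult_pos_pos[OF r(1) T] by linarith
    finally show "(norm2 (z - p))\<^sup>2 < M\<^sup>2" .
  qed (use M in simp)

  moreover have "f z < M"
  proof -
    \<comment> \<open>Since \<open>r \<le> 1\<close>, the identity \<open>rM\<close> gives
      \<open>4 * T\<close> at most the square of \<open>M\<close>, so \<open>w\<close> lies within
      \<open>2 * M\<close> of \<open>p\<close>.\<close>
    have "r * M\<^sup>2 \<le> M\<^sup>2" using r mult_right_mono[of r 1 "M\<^sup>2"] by simp
    then have "(norm2 (w - p))\<^sup>2 \<le> (2 * M)\<^sup>2"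
      using wp2 rM T by (simp add: power_mult_distrib)
    then have nwp: "norm2 (w - p) \<le> 2 * M"
      by (rule power2_le_imp_le) (use M in simp)
    have "f w \<le> (1 - s) * f x + s * f y"
      using cf xc yc s by (simp add: convex_fun_def w_def)
    also have "\<dots> \<le> (1 - s) * ((1 + \<epsilon>) * M) + s * (M / 4)"
      using fx fy s by (intro add_mono mult_left_mono) simp_all
    also have "\<dots> = (1 + \<epsilon> - 3 / 4 * s) * M - s * \<epsilon> * M" by (simp add: algebra_simps)
    also have "\<dots> \<le> (1 + \<epsilon> - 3 / 4 * s) * M" using s \<epsilon> M by simp
    \<comment> \<open>A square is used as bound so that its root is linear in
      \<open>s\<close>.\<close>
    also have "\<dots> \<le> (1 - s / 4)\<^sup>2 * M"
    proof (rule mult_right_mono)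
      have "(1 - s / 4)\<^sup>2 = 1 - s / 2 + s\<^sup>2 / 16" by (simp add: power2_eq_square field_simps)
      then show "1 + \<epsilon> - 3 / 4 * s \<le> (1 - s / 4)\<^sup>2"
        using \<epsilon>(2) zero_le_power2[of s] by linarith
    qed (use M in simp)
    finally have "sqrt (f w) \<le> sqrt ((1 - s / 4)\<^sup>2 * M)" by simp
    also have "\<dots> = (1 - s / 4) * \<mu>" using s by (simp add: real_sqrt_mult \<mu>_def)
    finally have fw: "sqrt (f w) \<le> (1 - s / 4) * \<mu>" .
    have "sqrt (f z) \<le> sqrt (f w) + \<sigma> * norm2 (z - w)"
      unfolding \<sigma>_def by (rule sqrt_smooth_lipschitz[OF \<beta> sm df nn wc zc])
    also have "norm2 (z - w) = r * norm2 (w - p)"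
      using r norm2_minus_commute[OF wc pc] by (simp add: zw norm2_smult)
    also have "\<sigma> * (r * norm2 (w - p)) \<le> \<sigma> * (r * (2 * M))"
      using \<sigma> r nwp by (intro mult_left_mono) simp_all
    also have "\<dots> = s / 12 * \<mu>"
      using \<sigma> \<mu> unfolding r_def \<mu>2[symmetric] by (simp add: field_simps)
    also note fw
    also have "(1 - s / 4) * \<mu> + s / 12 * \<mu> < \<mu>"
      using s \<mu> by (simp add: algebra_simps)
    finally have "sqrt (f z) < sqrt M" by (simp add: \<mu>_def)
    then show ?thesis by simp
  qed
  ultimately show False using lower[OF z] by simp
qed

text \<open>Writing \<open>p - y\<close> as \<open>(p - x) + (x - y)\<close> and applying
  Cauchy-Schwarz to its product with \<open>x - y\<close> leaves a common factor
  \<open>norm2 (x - y)\<close>. The strict hypothesis allows this factor to be cancelled, as it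
  excludes \<open>x = y\<close>.\<close>

lemma norm2_drop_ge:
  assumes c: "p \<in> carrier_vec d" "x \<in> carrier_vec d" "y \<in> carrier_vec d"
    and a: "c * norm2 (x - y) < (x - p) \<bullet> (y - x)"
  shows "c \<le> norm2 (p - y) - norm2 (x - y)"
proof -
  have "(x - p) \<bullet> (y - x) + (norm2 (x - y))\<^sup>2 = (p - y) \<bullet> (x - y)"
  proof -
    have "p - y = (p - x) + (x - y)" using c by auto
    then have "(p - y) \<bullet> (x - y) = (p - x) \<bullet> (x - y) + (norm2 (x - y))\<^sup>2"
      using c by (simp add: add_scalar_prod_distrib[of _ d] norm2_power2)
    moreover have "x - p = - (p - x)" "y - x = - (x - y)" using c by auto
    ultimately show ?thesis using c by simp
  qed
  also have "\<dots> \<le> norm2 (p - y) * norm2 (x - y)"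
    using scalar_prod_le_norm2[of "p - y" d "x - y"] c by simp
  finally have "c * norm2 (x - y) < (norm2 (p - y) - norm2 (x - y)) * norm2 (x - y)"
    using a by (simp add: algebra_simps power2_eq_square)
  then show ?thesis
    using norm2_nonneg[of "x - y"] mult_right_less_imp_less less_imp_le by metis
qed

section \<open>The amortized inequality for one request\<close>

text \<open>The potential is \<open>2304 * sqrt \<kappa>\<close> times the distance to the offline
  point, taken after the offline move. The point \<open>x\<close> must serve all \<open>y\<close> at
  once because the offline position is unknown online. The factor \<open>2304 = 4 * 576\<close>
  makes the guaranteed drop pay for \<open>4 * M\<close>, and
  \<open>18448 = 4 * (2 * 2304 + 4)\<close> covers the case \<open>f y \<ge> M / 4\<close>.\<close>

definition good_step :: "real \<Rightarrow> point set \<Rightarrow> point \<Rightarrow> request \<Rightarrow> point \<Rightarrow> bool" where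
  "good_step \<kappa> K p f x \<longleftrightarrow> x \<in> K \<and> (\<forall>y\<in>K.
    norm2 (x - p) + f x + 2304 * sqrt \<kappa> * norm2 (x - y)
      \<le> 2304 * sqrt \<kappa> * norm2 (p - y) + 18448 * sqrt \<kappa> * f y)"

lemma good_step_exists:
  assumes \<kappa>: "\<kappa> \<ge> 1" and f: "f \<in> requests d" and wc: "well_conditioned d \<kappa> f"
    and Kd: "K \<subseteq> carrier_vec d" and K: "convex_set K" and p: "p \<in> K"
  shows "\<exists>x. good_step \<kappa> K p f x"
proof -
  obtain \<alpha> where \<alpha>: "\<alpha> > 0" and sc: "strongly_convex d \<alpha> f" and sm: "smooth_fun d (\<alpha> * \<kappa>) f"
    using wc by (auto simp: well_conditioned_def)
  have df: "differentiable_fun d f" and nn: "\<And>u. u \<in> carrier_vec d \<Longrightarrow> f u \<ge> 0"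
    using f by (auto simp: requests_def)
  have \<beta>: "\<alpha> * \<kappa> > 0" using \<alpha> \<kappa> by simp
  have sq: "sqrt \<kappa> \<ge> 1" using \<kappa> by simp
  define \<sigma> where "\<sigma> = sqrt (\<alpha> * \<kappa> / 2)"
  have \<sigma>: "\<sigma> > 0" using \<beta> by (simp add: \<sigma>_def)
  have pc: "p \<in> carrier_vec d" using p Kd by auto
  define m where "m = (\<lambda>u. max (f u) (norm2 (u - p)))"
  define M where "M = Inf (m ` K)"
  have m0: "m u \<ge> 0" for u by (simp add: m_def norm2_nonneg le_max_iff_disj)
  have bdd: "bdd_below (m ` K)" using m0 by (auto intro!: bdd_belowI[of _ 0])
  have lower: "M \<le> m u" if "u \<in> K" for u
    unfolding M_def using bdd that by (intro cInf_lower) auto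
  show ?thesis
  proof (cases "f p = 0")
    \<comment> \<open>Here \<open>M = 0\<close>, so relative near-minimality is useless, but staying
      at \<open>p\<close> is free.\<close>
    case True
    have "norm2 (p - p) = 0" using pc by (simp add: norm2_def)
    then have "good_step \<kappa> K p f p"
      using True p \<kappa> nn Kd by (auto simp: good_step_def)
    then show ?thesis ..
  next
    case False
    then have fp: "f p > 0" using nn[OF pc] by simp
    define t where "t = sqrt (f p)"
    have t: "t > 0" using fp by (simp add: t_def)
    \<comment> \<open>Positivity of \<open>M\<close>: by the Lipschitz bound on
      \<open>sqrt f\<close>, a point of \<open>K\<close> either keeps half of
      \<open>sqrt (f p)\<close> or is at least \<open>t / (2 * \<sigma>)\<close> away from
      \<open>p\<close>.\<close>
    have "min ((t / 2)\<^sup>2) (t / (2 * \<sigma>)) \<le> m u" if u: "u \<in> K" for u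
    proof -
      have uc: "u \<in> carrier_vec d" using u Kd by auto
      have "t \<le> sqrt (f u) + \<sigma> * norm2 (u - p)"
        using sqrt_smooth_lipschitz[OF \<beta> sm df nn uc pc] norm2_minus_commute[OF uc pc]
        by (simp add: t_def \<sigma>_def)
      then consider "t / 2 \<le> sqrt (f u)" | "t / 2 \<le> \<sigma> * norm2 (u - p)" by linarith
      then show ?thesis
      proof cases
        case 1
        then have "(t / 2)\<^sup>2 \<le> (sqrt (f u))\<^sup>2" using t by (intro power_mono) simp_all
        then show ?thesis using nn[OF uc] by (simp add: m_def)
      next
        case 2
        then have "t / (2 * \<sigma>) \<le> norm2 (u - p)" using \<sigma> by (simp add: field_simps)
        then show ?thesis by (simp add: m_def)
      qed
    qed
    then have "min ((t / 2)\<^sup>2) (t / (2 * \<sigma>)) \<le> M"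
      unfolding M_def using p by (intro cInf_greatest) auto
    moreover have "min ((t / 2)\<^sup>2) (t / (2 * \<sigma>)) > 0" using t \<sigma> by simp
    ultimately have M: "M > 0" by linarith
    define s where "s = Min {1, 24 * \<sigma> * sqrt M, \<alpha> * sqrt M / (864 * \<sigma>)}"
    define \<epsilon> where "\<epsilon> = min (s / 4) (s / (288 * \<sigma> * sqrt M))"
    have s: "0 < s" "s \<le> 1" "s \<le> 24 * \<sigma> * sqrt M" "s \<le> \<alpha> * sqrt M / (864 * \<sigma>)"
      using M \<sigma> \<alpha> by (simp_all add: s_def)
    have \<epsilon>: "0 < \<epsilon>" "\<epsilon> \<le> s / 4" "\<epsilon> \<le> s / (288 * \<sigma> * sqrt M)"
      using s(1) M \<sigma> by (simp_all add: \<epsilon>_def)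
    have "M < (1 + \<epsilon>) * M" using \<epsilon> M by simp
    then have "\<exists>a\<in>m ` K. a < (1 + \<epsilon>) * M"
      unfolding M_def using p cInf_lessD[of "m ` K"] by blast
    then obtain x where x: "x \<in> K" and mx: "m x < (1 + \<epsilon>) * M" by auto
    have fx: "f x \<le> (1 + \<epsilon>) * M" and xp: "norm2 (x - p) \<le> (1 + \<epsilon>) * M"
      using mx by (simp_all add: m_def)
    have "(1 + \<epsilon>) * M \<le> 2 * M" using \<epsilon> s M by (intro mult_right_mono) simp_all
    with fx xp have fx2: "f x \<le> 2 * M" and xp2: "norm2 (x - p) \<le> 2 * M" by linarith+
    have xc: "x \<in> carrier_vec d" using x Kd by auto
    have "norm2 (x - p) + f x + 2304 * sqrt \<kappa> * norm2 (x - y)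
      \<le> 2304 * sqrt \<kappa> * norm2 (p - y) + 18448 * sqrt \<kappa> * f y" if y: "y \<in> K" for y
    proof (cases "f y < M / 4")
      case True
      have yc: "y \<in> carrier_vec d" using y Kd by auto
      have "M * norm2 (y - x) / (576 * sqrt \<kappa>) < (x - p) \<bullet> (y - x)"
        by (rule near_minimizer_angle[OF \<alpha> \<kappa> sc sm f Kd K p x y M])
          (use lower s \<epsilon> fx xp True in \<open>simp_all add: m_def \<sigma>_def\<close>)
      then have "M / (576 * sqrt \<kappa>) * norm2 (x - y) < (x - p) \<bullet> (y - x)"
        using norm2_minus_commute[OF xc yc] by simp
      then have "M / (576 * sqrt \<kappa>) \<le> norm2 (p - y) - norm2 (x - y)"
        by (rule norm2_drop_ge[OF pc xc yc])
      then have "2304 * sqrt \<kappa> * (M / (576 * sqrt \<kappa>))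
          \<le> 2304 * sqrt \<kappa> * (norm2 (p - y) - norm2 (x - y))"
        using sq by (intro mult_left_mono) simp_all
      then have "4 * M \<le> 2304 * sqrt \<kappa> * norm2 (p - y) - 2304 * sqrt \<kappa> * norm2 (x - y)"
        using sq by (simp add: right_diff_distrib)
      moreover have "18448 * sqrt \<kappa> * f y \<ge> 0" using sq nn[OF yc] by simp
      ultimately show ?thesis using fx2 xp2 by linarith
    next
      case False
      have yc: "y \<in> carrier_vec d" using y Kd by auto
      \<comment> \<open>The potential may grow here; growth and cost are at most a multiple of
        \<open>sqrt \<kappa> * M\<close>, and \<open>M \<le> 4 * f y\<close>.\<close>
      have "norm2 (x - y) \<le> norm2 (p - y) + 2 * M"
        using norm2_diff_triangle[OF xc pc yc] xp2 by linarith
      then have "2304 * sqrt \<kappa> * norm2 (x - y) \<le> 2304 * sqrt \<kappa> * (norm2 (p - y) + 2 * M)"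
        using sq by (intro mult_left_mono) simp_all
      moreover have "M \<le> sqrt \<kappa> * M" using sq M by simp
      moreover have "sqrt \<kappa> * M \<le> sqrt \<kappa> * (4 * f y)"
        using False sq by (intro mult_left_mono) simp_all
      ultimately show ?thesis using fx2 xp2 by (simp add: algebra_simps)
    qed
    then show ?thesis using x by (auto simp: good_step_def)
  qed
qed

section \<open>The online algorithm and its competitive ratio\<close>

text \<open>
  A good step may fail to exist for ill-conditioned requests, where the algorithm still has to
  stay in \<open>K\<close>.
\<close>

definition step :: "real \<Rightarrow> point set \<Rightarrow> point \<Rightarrow> request \<Rightarrow> point" where
  "step \<kappa> K p f = (if \<exists>x. good_step \<kappa> K p f x then SOME x. good_step \<kappa> K p f x else p)"

definition potential_alg :: "real \<Rightarrow> algorithm" where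
  "potential_alg \<kappa> d K x\<^sub>0 fs = foldl (step \<kappa> K) x\<^sub>0 fs"

lemma step_good: "good_step \<kappa> K p f x \<Longrightarrow> good_step \<kappa> K p f (step \<kappa> K p f)"
  unfolding step_def by (metis someI)

lemma step_in: "p \<in> K \<Longrightarrow> step \<kappa> K p f \<in> K"
  using step_good[of \<kappa> K p f] by (metis good_step_def step_def)

lemma foldl_step_in: "p \<in> K \<Longrightarrow> foldl (step \<kappa> K) p fs \<in> K"
  by (induction fs arbitrary: p) (auto simp: step_in)

lemma actions_potential_alg_Cons:
  "actions (potential_alg \<kappa>) d K p (f # fs)
    = step \<kappa> K p f # actions (potential_alg \<kappa>) d K (step \<kappa> K p f) fs"
  unfolding actions_def length_Cons
  by (simp only: map_upt_Suc) (simp add: potential_alg_def)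

lemma cost_Cons:
  "cost p (f # fs) (x # xs) = norm2 (x - p) + f x + cost x fs xs"
  by (simp only: cost_def length_Cons sum.lessThan_Suc_shift) simp

lemma online_algorithm_potential_alg: "online_algorithm (potential_alg \<kappa>)"
  by (auto simp: online_algorithm_def actions_def potential_alg_def cfc_instance_def
      intro: foldl_step_in)

text \<open>Summing the amortized inequality over the rounds. Separate starting points
  \<open>p\<close> and \<open>q\<close> make the induction possible, since the two sequences diverge
  after one round; the initial potential stays on the right.\<close>

lemma cost_potential_alg_le:
  assumes \<kappa>: "\<kappa> \<ge> 1" and Kd: "K \<subseteq> carrier_vec d" and K: "convex_set K"
    and "p \<in> K" "q \<in> K" "length ys = length fs" "set ys \<subseteq> K"
    and "\<forall>f\<in>set fs. f \<in> requests d \<and> well_conditioned d \<kappa> f"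
  shows "cost p fs (actions (potential_alg \<kappa>) d K p fs)
    \<le> 2304 * sqrt \<kappa> * norm2 (p - q) + 18448 * sqrt \<kappa> * cost q fs ys"
  using assms(4-)
proof (induction fs arbitrary: p q ys)
  case Nil
  then show ?case using \<kappa> by (simp add: cost_def norm2_nonneg)
next
  case (Cons f fs)
  then obtain y ys' where ys: "ys = y # ys'" by (cases ys) auto
  define x where "x = step \<kappa> K p f"
  have f: "f \<in> requests d" "well_conditioned d \<kappa> f" and y: "y \<in> K" using Cons.prems ys by auto
  have x: "x \<in> K" using Cons.prems step_in by (simp add: x_def)
  have "good_step \<kappa> K p f x"
    unfolding x_def using good_step_exists[OF \<kappa> f Kd K \<open>p \<in> K\<close>] step_good by blast
  then have 1: "norm2 (x - p) + f x + 2304 * sqrt \<kappa> * norm2 (x - y)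
      \<le> 2304 * sqrt \<kappa> * norm2 (p - y) + 18448 * sqrt \<kappa> * f y"
    using y by (simp add: good_step_def)
  have 2: "cost x fs (actions (potential_alg \<kappa>) d K x fs)
      \<le> 2304 * sqrt \<kappa> * norm2 (x - y) + 18448 * sqrt \<kappa> * cost y fs ys'"
    using Cons.IH[of x y ys'] Cons.prems ys x y by simp
  have c: "p \<in> carrier_vec d" "q \<in> carrier_vec d" "y \<in> carrier_vec d"
    using Cons.prems y Kd by auto
  have "norm2 (p - y) \<le> norm2 (p - q) + norm2 (y - q)"
    using norm2_diff_triangle[OF c] norm2_minus_commute[OF c(2,3)] by simp
  then have "2304 * sqrt \<kappa> * norm2 (p - y) \<le> 2304 * sqrt \<kappa> * (norm2 (p - q) + norm2 (y - q))"
    using \<kappa> by (intro mult_left_mono) simp_all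
  \<comment> \<open>The offline move raises the potential, which is charged to the offline movement
    cost.\<close>
  moreover have "2304 * sqrt \<kappa> * norm2 (y - q) \<le> 18448 * sqrt \<kappa> * norm2 (y - q)"
    using \<kappa> by (intro mult_right_mono) (simp_all add: norm2_nonneg)
  ultimately show ?case
    using 1 2
    by (simp add: ys actions_potential_alg_Cons cost_Cons flip: x_def) (simp add: algebra_simps)
qed

lemma competitive_potential_alg:
  assumes \<kappa>: "\<kappa> \<ge> 1"
  shows "competitive_on (well_conditioned_instance \<kappa>) (18448 * sqrt \<kappa>) (potential_alg \<kappa>)"
  unfolding competitive_on_def
proof (intro allI impI)
  fix d K x\<^sub>0 fs
  assume "well_conditioned_instance \<kappa> d K x\<^sub>0 fs"
  then have Kd: "K \<subseteq> carrier_vec d" and K: "convex_set K" and x0: "x\<^sub>0 \<in> K"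
    and fs: "\<forall>f\<in>set fs. f \<in> requests d \<and> well_conditioned d \<kappa> f"
    by (auto simp: well_conditioned_instance_def cfc_instance_def)
  define c where "c = cost x\<^sub>0 fs (actions (potential_alg \<kappa>) d K x\<^sub>0 fs)"
  have k: "18448 * sqrt \<kappa> > 0" using \<kappa> by simp
  have "norm2 (x\<^sub>0 - x\<^sub>0) = 0" using x0 Kd by (auto simp: norm2_def)
  then have le: "c \<le> 18448 * sqrt \<kappa> * cost x\<^sub>0 fs ys"
    if "length ys = length fs" "set ys \<subseteq> K" for ys
    using cost_potential_alg_le[OF \<kappa> Kd K x0 x0 that fs] by (simp add: c_def)
  \<comment> \<open>The infimum may not be attained, so the quotient is shown to be a lower bound of
    all offline costs; staying at the start shows that the set is nonempty.\<close>
  have "c / (18448 * sqrt \<kappa>) \<le> OPT K x\<^sub>0 fs"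
    unfolding OPT_def
  proof (rule cInf_greatest)
    have "length (replicate (length fs) x\<^sub>0) = length fs" "set (replicate (length fs) x\<^sub>0) \<subseteq> K"
      using x0 by auto
    then show "{cost x\<^sub>0 fs ys |ys. length ys = length fs \<and> set ys \<subseteq> K} \<noteq> {}" by blast
  next
    fix v assume "v \<in> {cost x\<^sub>0 fs ys |ys. length ys = length fs \<and> set ys \<subseteq> K}"
    then have "c \<le> 18448 * sqrt \<kappa> * v" using le by auto
    then show "c / (18448 * sqrt \<kappa>) \<le> v" using k by (simp add: divide_le_eq mult.commute)
  qed
  then have "c \<le> 18448 * sqrt \<kappa> * OPT K x\<^sub>0 fs"
    using k by (simp add: divide_le_eq mult.commute)
  then show "cost x\<^sub>0 fs (actions (potential_alg \<kappa>) d K x\<^sub>0 fs) \<le> 18448 * sqrt \<kappa> * OPT K x\<^sub>0 fs"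
    by (simp add: c_def)
qed

theorem theorem1:
  shows "\<exists>C::real. C > 0 \<and> (\<forall>\<kappa>::real. \<kappa> \<ge> 1 \<longrightarrow>
    (\<exists>A. online_algorithm A \<and>
      competitive_on (well_conditioned_instance \<kappa>) (C * sqrt \<kappa>) A))"
proof (intro exI[of _ 18448] conjI allI impI)
  fix \<kappa> :: real
  assume "\<kappa> \<ge> 1"
  then show "\<exists>A. online_algorithm A \<and>
      competitive_on (well_conditioned_instance \<kappa>) (18448 * sqrt \<kappa>) A"
    using online_algorithm_potential_alg competitive_potential_alg by blast
qed simp

end
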